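(* Let $m$ and $n$ be positive integers and let $\delta$ be a real number with $\sin\delta\neq 0$. If the polynomial $$T_n(x)^2-2T_n(x)T_m(y)\cos\delta+T_m(y)^2-\sin^2\delta\in\mathbb{R}[x,y]$$ is irreducible over $\mathbb{R}$, then $m$ and $n$ are coprime.
   Context: For a nonnegative integer $k$, $T_k$ denotes the $k$-th Chebyshev polynomial of the first kind, i.e. the unique polynomial with $T_k(\cos\theta)=\cos k\theta$ for all real $\theta$. *)

theory Defs
  imports Complex_Main "HOL-Computational_Algebra.Computational_Algebra"
begin

definition Cheb_T :: "nat \<Rightarrow> real poly" where
  "Cheb_T k = (THE p. \<forall>\<theta>::real. poly p (cos \<theta>) = cos (of_nat k * \<theta>))"

lemma Cheb_poly_ex:
  "\<exists>p::real poly. \<forall>\<theta>::real. poly p (cos \<theta>) = cos (of_nat k * \<theta>)"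
proof (induction k rule: less_induct)
  case (less k)
  show ?case
  proof (cases "k < 2")
    case True
    then consider "k = 0" | "k = 1" by linarith
    then show ?thesis
    proof cases
      case 1
      then show ?thesis by (intro exI[of _ "1"]) simp
    next
      case 2
      then show ?thesis by (intro exI[of _ "[:0, 1:]"]) simp
    qed
  next
    case False
    then obtain j where k: "k = Suc (Suc j)"
      by (metis add_2_eq_Suc le_Suc_ex not_less)
    obtain p q :: "real poly"
      where p: "\<And>\<theta>. poly p (cos \<theta>) = cos (of_nat (Suc j) * \<theta>)"
        and q: "\<And>\<theta>. poly q (cos \<theta>) = cos (of_nat j * \<theta>)"
      using less.IH[of "Suc j"] less.IH[of j] k by auto
    have "poly ([:0, 2:] * p - q) (cos \<theta>) = cos (of_nat k * \<theta>)" for \<theta> :: real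
    proof -
      have "cos (of_nat k * \<theta>) = cos (of_nat (Suc j) * \<theta> + \<theta>)"
        by (simp add: k algebra_simps)
      moreover have "cos (of_nat j * \<theta>) = cos (of_nat (Suc j) * \<theta> - \<theta>)"
        by (simp add: algebra_simps)
      ultimately show ?thesis
        by (simp add: p q cos_add cos_diff del: of_nat_Suc)
    qed
    then show ?thesis by blast
  qed
qed

lemma Cheb_poly_unique:
  fixes p q :: "real poly"
  assumes "\<forall>\<theta>::real. poly p (cos \<theta>) = cos (of_nat k * \<theta>)"
    and "\<forall>\<theta>::real. poly q (cos \<theta>) = cos (of_nat k * \<theta>)"
  shows "p = q"
proof (rule ccontr)
  assume "p \<noteq> q"
  then have fin: "finite {x. poly (p - q) x = 0}"
    by (intro poly_roots_finite) simp
  have "{-1..1} \<subseteq> {x. poly (p - q) x = 0}"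
  proof
    fix x :: real assume "x \<in> {-1..1}"
    then have "cos (arccos x) = x" by simp
    with assms[THEN spec, of "arccos x"] show "x \<in> {x. poly (p - q) x = 0}" by simp
  qed
  then have "finite {-1..1::real}" using fin by (rule finite_subset)
  then show False using infinite_Icc[of "-1" "1::real"] by simp
qed

lemma Cheb_T_cos: "poly (Cheb_T k) (cos \<theta>) = cos (of_nat k * \<theta>)"
proof -
  have "\<exists>!p::real poly. \<forall>\<theta>::real. poly p (cos \<theta>) = cos (of_nat k * \<theta>)"
    using Cheb_poly_ex[of k] Cheb_poly_unique[of _ k] by blast
  from theI'[OF this] show ?thesis by (simp add: Cheb_T_def)
qed

text \<open>
  The ring $R[x,y]$ is represented as $R[x][y]$, the type \<^typ>\<open>real poly poly\<close>: the inner
  variable is $x$ and the outer one is $y$.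
\<close>

definition const_xy :: "real \<Rightarrow> real poly poly" where
  "const_xy c = [:[:c:]:]"

definition poly_in_x :: "real poly \<Rightarrow> real poly poly" where
  "poly_in_x p = [:p:]"

definition poly_in_y :: "real poly \<Rightarrow> real poly poly" where
  "poly_in_y p = map_poly (\<lambda>c. [:c:]) p"

definition eval_xy :: "real poly poly \<Rightarrow> real \<Rightarrow> real \<Rightarrow> real" where
  "eval_xy F x y = poly (poly F [:y:]) x"

lemma eval_xy_simps [simp]:
  "eval_xy (const_xy c) x y = c"
  "eval_xy (poly_in_x p) x y = poly p x"
  "eval_xy (poly_in_y p) x y = poly p y"
proof -
  show "eval_xy (poly_in_y p) x y = poly p y"
    by (induction p) (simp_all add: eval_xy_def poly_in_y_def map_poly_pCons)
qed (simp_all add: eval_xy_def const_xy_def poly_in_x_def)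

definition lissajous_poly :: "nat \<Rightarrow> nat \<Rightarrow> real \<Rightarrow> real poly poly" where
  "lissajous_poly m n \<delta> =
     (poly_in_x (Cheb_T n))\<^sup>2
     - 2 * poly_in_x (Cheb_T n) * poly_in_y (Cheb_T m) * const_xy (cos \<delta>)
     + (poly_in_y (Cheb_T m))\<^sup>2 - const_xy ((sin \<delta>)\<^sup>2)"

lemma eval_xy_lissajous_poly:
  "eval_xy (lissajous_poly m n \<delta>) x y =
     (poly (Cheb_T n) x)\<^sup>2 - 2 * poly (Cheb_T n) x * poly (Cheb_T m) y * cos \<delta>
     + (poly (Cheb_T m) y)\<^sup>2 - (sin \<delta>)\<^sup>2"
  using eval_xy_simps by (simp add: lissajous_poly_def eval_xy_def)

end

theory Submission
  imports Defs
begin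

text \<open>
  At \<open>x = cos a\<close>, \<open>y = cos b\<close> the polynomial factors as
  \<open>(cos (n a + m b) - cos \<delta>) (cos (n a - m b) - cos \<delta>)\<close>.
  If \<open>m = m' d\<close> and \<open>n = n' d\<close>, then \<open>cos t = cos (\<delta> / d)\<close> implies \<open>cos (d t) = cos \<delta>\<close>,
  so the polynomial for \<open>m', n', \<delta> / d\<close> divides the one for \<open>m, n, \<delta>\<close>. The quotient is not a
  unit when \<open>d \<ge> 2\<close>, because it vanishes on the curve for \<open>m', n', (\<delta> + 2 \<pi>) / d\<close>.
\<close>

lemma eval_xy_diff: "eval_xy (F - G) x y = eval_xy F x y - eval_xy G x y"
  by (simp add: eval_xy_def)

lemma eval_xy_mult: "eval_xy (F * G) x y = eval_xy F x y * eval_xy G x y"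
  by (simp add: eval_xy_def)

text \<open>Over the integral domain \<open>real poly\<close>, the nonzero polynomial
  \<open>F - G\<close> has only finitely many roots, but each constant \<open>[:y:]\<close> would be
  one.\<close>

lemma eval_xy_eqI:
  assumes "\<And>x y. eval_xy F x y = eval_xy G x y"
  shows "F = G"
proof (rule ccontr)
  assume "F \<noteq> G"
  then have "finite {c. poly (F - G) c = 0}"
    by (intro poly_roots_finite) simp
  moreover have "range (\<lambda>y. [:y:]) \<subseteq> {c. poly (F - G) c = 0}"
    using assms by (auto simp: eval_xy_def poly_eq_poly_eq_iff[symmetric] fun_eq_iff)
  ultimately have "finite (range (\<lambda>y::real. [:y:]))"
    by (rule finite_subset[rotated])
  moreover have "inj (\<lambda>y::real. [:y:])"
    by (auto simp: inj_on_def)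
  ultimately show False
    using finite_imageD infinite_UNIV_char_0 by blast
qed

lemma not_unit_if_eval_xy_zero:
  assumes "eval_xy F x y = 0"
  shows "\<not> F dvd 1"
proof
  assume "F dvd 1"
  then obtain G where "1 = F * G" ..
  then have "eval_xy 1 x y = eval_xy F x y * eval_xy G x y"
    by (metis eval_xy_mult)
  with assms show False
    by (simp add: eval_xy_def)
qed

text \<open>Serves to carry the quotient found for equal indices \<open>d\<close>, \<open>d\<close>
  over to general ones, with Chebyshev polynomials put in for both variables.\<close>

definition subst_xy :: "real poly \<Rightarrow> real poly \<Rightarrow> real poly poly \<Rightarrow> real poly poly" where
  "subst_xy p q F = pcompose (map_poly (\<lambda>c. pcompose c p) F) (poly_in_y q)"

lemma eval_subst_xy: "eval_xy (subst_xy p q F) x y = eval_xy F (poly p x) (poly q y)"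
proof -
  have "poly (poly (poly_in_y q) [:y:]) x = poly q y"
    using eval_xy_simps(3) by (simp add: eval_xy_def)
  then show ?thesis
    by (induction F)
       (simp_all add: subst_xy_def eval_xy_def map_poly_pCons pcompose_pCons poly_pcompose)
qed

lemma poly_Cheb_T_mult: "poly (Cheb_T (k * d)) x = poly (Cheb_T d) (poly (Cheb_T k) x)"
proof -
  have "Cheb_T (k * d) = pcompose (Cheb_T d) (Cheb_T k)"
    by (rule Cheb_poly_unique[of _ "k * d"]) (simp_all add: Cheb_T_cos poly_pcompose mult_ac)
  then show ?thesis
    by (simp add: poly_pcompose)
qed

lemma Cheb_T_1: "Cheb_T (Suc 0) = [:0, 1:]"
  by (rule Cheb_poly_unique[of _ 1]) (simp_all add: Cheb_T_cos)

lemma eval_lissajous_cos: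
  "eval_xy (lissajous_poly m n \<delta>) (cos a) (cos b) =
     (cos (n * a + m * b) - cos \<delta>) * (cos (n * a - m * b) - cos \<delta>)"
proof -
  define A B where "A = n * a" and "B = m * b"
  have "(cos (A + B) - cos \<delta>) * (cos (A - B) - cos \<delta>) =
      (cos A)\<^sup>2 * (cos B)\<^sup>2 - (sin A)\<^sup>2 * (sin B)\<^sup>2 - 2 * cos A * cos B * cos \<delta> + (cos \<delta>)\<^sup>2"
    by (simp add: cos_add cos_diff power2_eq_square algebra_simps)
  also have "\<dots> = (cos A)\<^sup>2 - 2 * cos A * cos B * cos \<delta> + (cos B)\<^sup>2 - (sin \<delta>)\<^sup>2"
    by (simp add: sin_squared_eq algebra_simps)
  finally show ?thesis
    by (simp add: eval_xy_lissajous_poly Cheb_T_cos A_def B_def)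
qed

text \<open>Makes visible a monic quadratic in the outer variable y, by which one can divide with
  remainder although \<open>real poly\<close> is not a field.\<close>

lemma lissajous_poly_1_1:
  "lissajous_poly 1 1 \<delta> = [:[:- (sin \<delta>)\<^sup>2, 0, 1:], [:0, - 2 * cos \<delta>:], 1:]"
  by (rule eval_xy_eqI, simp add: eval_xy_lissajous_poly Cheb_T_1)
     (simp add: eval_xy_def power2_eq_square algebra_simps)

lemma sin_divide_nonzero:
  assumes "sin t \<noteq> 0" and "d > (0::nat)"
  shows "sin (t / d) \<noteq> 0"
proof
  assume "sin (t / d) = 0"
  then obtain i :: int where "t / d = of_int i * pi"
    by (auto simp: sin_zero_iff_int2)
  then have "t = of_int (i * int d) * pi"
    using \<open>d > 0\<close> by (simp add: field_simps)
  with assms(1) show False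
    unfolding sin_zero_iff_int2 by blast
qed

text \<open>Division leaves a remainder r0(x) + r1(x) y. For x = cos a in (-1, 1) it vanishes at y =
  cos (a + e) and y = cos (a - e), where e = \<delta> / d. These values differ by 2 sin a sin e
  \<noteq> 0, so r0 and r1 vanish on the whole interval and are zero.\<close>

lemma lissajous_poly_dvd_diagonal:
  assumes "sin \<delta> \<noteq> 0" and "d > 0"
  shows "lissajous_poly 1 1 (\<delta> / d) dvd lissajous_poly d d \<delta>"
proof -
  define e where "e = \<delta> / d"
  define g where "g = lissajous_poly 1 1 e"
  have g: "degree g = 2" "lead_coeff g = 1"
    unfolding g_def lissajous_poly_1_1 by simp_all
  \<comment> \<open>As \<open>g\<close> has leading coefficient 1, the scaling factor of
    pseudo-division is 1.\<close>
  obtain q r where qr: "pseudo_divmod (lissajous_poly d d \<delta>) g = (q, r)"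
    by fastforce
  have "g \<noteq> 0"
    using g(1) by auto
  then have eq: "lissajous_poly d d \<delta> = g * q + r" and deg: "degree r < 2"
    using pseudo_divmod[OF _ qr] g by auto
  define r0 r1 where "r0 = coeff r 0" and "r1 = coeff r 1"
  have r: "r = [:r0, r1:]"
    by (rule poly_eqI)
       (use deg in \<open>auto simp: r0_def r1_def coeff_pCons coeff_eq_0 split: nat.split\<close>)
  have zero: "poly r0 x = 0 \<and> poly r1 x = 0" if "x \<in> {-1<..<1}" for x
  proof -
    define a where "a = arccos x"
    have x: "x = cos a"
      using that by (simp add: a_def)
    have "sin a \<noteq> 0"
      using that by (simp add: a_def sin_arccos_nonzero)
    \<comment> \<open>These points lie on both curves: the difference of angles is -s e for
      \<open>g\<close> and -s \<delta> for the dividend, and cosine is even.\<close>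
    have "eval_xy r x (cos (a + s * e)) = 0" if "s = 1 \<or> s = -1" for s
    proof -
      have "d * a - d * (a + s * e) = - (s * \<delta>)"
        using \<open>d > 0\<close> by (simp add: e_def field_simps)
      then have "cos (d * a - d * (a + s * e)) = cos \<delta>"
        using that by auto
      then have "eval_xy (lissajous_poly d d \<delta>) x (cos (a + s * e)) = 0"
        unfolding x eval_lissajous_cos by simp
      moreover have "eval_xy g x (cos (a + s * e)) = 0"
        using that unfolding x g_def eval_lissajous_cos by auto
      moreover have "r = lissajous_poly d d \<delta> - g * q"
        using eq by simp
      ultimately show ?thesis
        by (simp add: eval_xy_diff eval_xy_mult)
    qed
    from this[of 1] this[of "-1"]
    have 1: "poly r0 x + cos (a + e) * poly r1 x = 0" "poly r0 x + cos (a - e) * poly r1 x = 0"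
      by (simp_all add: r eval_xy_def)
    then have "(cos (a - e) - cos (a + e)) * poly r1 x = 0"
      unfolding left_diff_distrib by linarith
    moreover have "cos (a - e) - cos (a + e) = 2 * sin a * sin e"
      by (simp add: cos_add cos_diff)
    moreover have "sin e \<noteq> 0"
      unfolding e_def by (intro sin_divide_nonzero assms)
    ultimately have "poly r1 x = 0"
      using \<open>sin a \<noteq> 0\<close> by simp
    with 1 show ?thesis
      by simp
  qed
  have vanish: "p = 0" if "\<And>x. x \<in> {-1<..<1} \<Longrightarrow> poly p x = 0" for p :: "real poly"
  proof (rule ccontr)
    assume "p \<noteq> 0"
    then have "finite {x. poly p x = 0}"
      by (rule poly_roots_finite)
    then have "finite {-1<..<1::real}"
      by (rule rev_finite_subset) (use that in auto)
    then show False
      using infinite_Ioo[of "-1" "1::real"] by simp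
  qed
  have "r = 0"
    using vanish[of r0] vanish[of r1] zero by (simp add: r)
  with eq show ?thesis
    by (simp add: g_def e_def)
qed

lemma eval_lissajous_mult:
  "eval_xy (lissajous_poly (m * d) (n * d) \<delta>) x y =
     eval_xy (lissajous_poly d d \<delta>) (poly (Cheb_T n) x) (poly (Cheb_T m) y)"
  by (simp add: eval_xy_lissajous_poly poly_Cheb_T_mult)

text \<open>Since T_{nd} is T_d composed with T_n, putting T_n(x) and T_m(y) for x and y in the
  factorization for \<open>d\<close>, \<open>d\<close> gives this one.\<close>

lemma lissajous_poly_dvd:
  assumes "sin \<delta> \<noteq> 0" and "d > 0"
  shows "lissajous_poly m n (\<delta> / d) dvd lissajous_poly (m * d) (n * d) \<delta>"
proof -
  obtain h where h: "lissajous_poly d d \<delta> = lissajous_poly 1 1 (\<delta> / d) * h"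
    using lissajous_poly_dvd_diagonal[OF assms] unfolding dvd_def by blast
  have base: "eval_xy (lissajous_poly m n (\<delta> / d)) x y =
      eval_xy (lissajous_poly 1 1 (\<delta> / d)) (poly (Cheb_T n) x) (poly (Cheb_T m) y)" for x y
    using eval_lissajous_mult[of m 1 n] by simp
  have "lissajous_poly (m * d) (n * d) \<delta> =
      lissajous_poly m n (\<delta> / d) * subst_xy (Cheb_T n) (Cheb_T m) h"
    by (rule eval_xy_eqI)
       (simp only: eval_lissajous_mult base h eval_xy_mult eval_subst_xy)
  then show ?thesis ..
qed

text \<open>The difference of the cosines is a product of sines: sin ((\<delta> + pi) / d) is
  nonzero because sin (\<delta> + pi) = - sin \<delta>, and 0 < pi / d < pi because d \<ge>
  2.\<close>

lemma cos_shift_divide_neq: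
  assumes "sin \<delta> \<noteq> 0" and "d \<ge> (2::nat)"
  shows "cos ((\<delta> + 2 * pi) / d) \<noteq> cos (\<delta> / d)"
proof -
  have "cos (\<delta> / d) - cos ((\<delta> + 2 * pi) / d) = 2 * sin ((\<delta> + pi) / d) * sin (pi / d)"
    by (simp add: cos_diff_cos add_divide_distrib diff_divide_distrib field_simps)
  moreover have "sin ((\<delta> + pi) / d) \<noteq> 0"
    using assms by (intro sin_divide_nonzero) auto
  moreover have "sin (pi / d) > 0"
    using assms(2) by (intro sin_gt_zero) (auto simp: field_simps)
  ultimately show ?thesis
    by auto
qed

lemma lissajous_poly_reducible:
  assumes "m > 0" and "n > 0" and "sin \<delta> \<noteq> 0" and "d \<ge> 2"
  shows "\<not> irreducible (lissajous_poly (m * d) (n * d) \<delta>)"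
proof -
  define g where "g = lissajous_poly m n (\<delta> / d)"
  have "d > 0"
    using assms(4) by simp
  obtain h where h: "lissajous_poly (m * d) (n * d) \<delta> = g * h"
    using lissajous_poly_dvd[OF assms(3) \<open>d > 0\<close>] unfolding g_def dvd_def by blast
  \<comment> \<open>With these angles both n k a and m k b equal k t / 2, so their sum is k t and
    their difference 0; the second factor no longer depends on t.\<close>
  have eval: "eval_xy (lissajous_poly (m * k) (n * k) \<epsilon>) (cos (t / (2 * n))) (cos (t / (2 * m)))
      = (cos (k * t) - cos \<epsilon>) * (1 - cos \<epsilon>)" for k t \<epsilon>
  proof -
    have "real (n * k) * (t / (2 * n)) = k * t / 2" "real (m * k) * (t / (2 * m)) = k * t / 2"
      using assms(1,2) by (simp_all add: field_simps)
    then show ?thesis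
      by (simp only: eval_lissajous_cos) (simp add: mult.commute)
  qed
  have "\<not> g dvd 1"
    using eval[where k = 1 and t = "\<delta> / d" and \<epsilon> = "\<delta> / d"]
    by (intro not_unit_if_eval_xy_zero) (simp add: g_def)
  moreover have "\<not> h dvd 1"
  proof -
    \<comment> \<open>Now cos (d t) = cos \<delta> but cos t \<noteq> cos (\<delta> / d), so at this
      point \<open>g * h\<close> vanishes and \<open>g\<close> does not, which forces a zero of
      \<open>h\<close>.\<close>
    define t where "t = (\<delta> + 2 * pi) / d"
    have "d * t = \<delta> + 2 * pi"
      using \<open>d > 0\<close> by (simp add: t_def)
    then have "eval_xy (g * h) (cos (t / (2 * n))) (cos (t / (2 * m))) = 0"
      unfolding h[symmetric] eval by simp
    moreover have "cos (\<delta> / d) \<noteq> 1"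
      using sin_divide_nonzero[OF assms(3) \<open>d > 0\<close>] cos_one_sin_zero by blast
    then have "eval_xy g (cos (t / (2 * n))) (cos (t / (2 * m))) \<noteq> 0"
      using eval[where k = 1 and t = t and \<epsilon> = "\<delta> / d"]
        cos_shift_divide_neq[OF assms(3,4)]
      by (simp add: g_def t_def)
    ultimately show ?thesis
      by (intro not_unit_if_eval_xy_zero) (simp add: eval_xy_mult)
  qed
  ultimately show ?thesis
    unfolding h using irreducibleD by blast
qed

theorem theorem5:
  fixes m n :: nat and \<delta> :: real
  assumes "m > 0" and "n > 0"
    and "sin \<delta> \<noteq> 0"
    and "irreducible (lissajous_poly m n \<delta>)"
  shows "coprime m n"
proof (rule ccontr)
  assume "\<not> coprime m n"
  define d where "d = gcd m n"
  have "d > 0" "d \<noteq> 1"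
    using assms(1) \<open>\<not> coprime m n\<close> by (auto simp: d_def coprime_iff_gcd_eq_1)
  then have "d \<ge> 2"
    by simp
  obtain m' n' where "m = m' * d" "n = n' * d"
    unfolding d_def by (metis dvdE gcd_dvd1 gcd_dvd2 mult.commute)
  with assms lissajous_poly_reducible[OF _ _ assms(3) \<open>d \<ge> 2\<close>, of m' n'] show False
    by simp
qed

end
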